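(* Let $K$ be an irreducible Markov kernel on a finite state space $\mathcal{X}$ with invariant probability measure $\pi$, and let $H_t=e^{-t(I-K)}$ be the associated continuous-time chain. For $\epsilon>0$, the $L^\infty$ mixing time $\tau_\infty(\epsilon)$ for the chain $H_t(x,y)$ satisfies $$\tau_{\infty}(\epsilon) \leq \int_{4\pi_*}^{4/\epsilon} \frac{2\,dv}{v\, \Lambda(v)}.$$
   Context: $K$ is not assumed reversible. $\pi$ is the unique invariant probability measure of $K$ ($\sum_x \pi(x)K(x,y)=\pi(y)$), and $\pi_*=\min_x\pi(x)>0$. $H_t(x,y)$ is the kernel of $H_t=e^{-t(I-K)}$, i.e. $H_t(x,y)=e^{-t}\sum_{n\ge0}\frac{t^n}{n!}K^n(x,y)$. The $L^\infty$ mixing time is $$\tau_\infty(\epsilon)=\inf\Big\{t>0:\ \sup_{x,y\in\mathcal X}\Big|\frac{H_t(x,y)-\pi(y)}{\pi(y)}\Big|\le\epsilon\Big\}.$$ Dirichlet form: $\mathcal{E}(f,g)=\langle (I-K)f,g\rangle_\pi=\sum_{x}((I-K)f)(x)g(x)\pi(x)$ for $f,g:\mathcal X\to\mathbb R$; $\mathrm{Var}(f)$ is the variance with respect to $\pi$. For non-empty $S\subset\mathcal X$, $$\lambda(S)=\inf_{f\in c_0^+(S)}\frac{\mathcal E(f,f)}{\mathrm{Var}(f)},\qquad c_0^+(S)=\{f:\mathcal X\to\mathbb R:\ \mathrm{supp}(f)\subset S,\ f\ge0,\ f\ne \text{constant}\}.$$ The spectral profile is $\Lambda:[\pi_*,\infty)\to\mathbb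 R$, $\Lambda(r)=\inf_{\pi_*\le\pi(S)\le r}\lambda(S)$. *)

theory Defs
  imports "HOL-Analysis.Analysis"
begin

text \<open>Kernels on a finite state space \<open>'a\<close> are functions \<open>'a \<Rightarrow> 'a \<Rightarrow> real\<close>, measures on it are
  functions \<open>'a \<Rightarrow> real\<close>.\<close>

definition markov_kernel :: "('a::finite \<Rightarrow> 'a \<Rightarrow> real) \<Rightarrow> bool" where
  "markov_kernel K \<longleftrightarrow> (\<forall>x y. 0 \<le> K x y) \<and> (\<forall>x. (\<Sum>y\<in>UNIV. K x y) = 1)"

fun kernel_power :: "('a::finite \<Rightarrow> 'a \<Rightarrow> real) \<Rightarrow> nat \<Rightarrow> 'a \<Rightarrow> 'a \<Rightarrow> real" where
  "kernel_power K 0 x y = (if x = y then 1 else 0)"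
| "kernel_power K (Suc n) x y = (\<Sum>z\<in>UNIV. K x z * kernel_power K n z y)"

definition irreducible_kernel :: "('a::finite \<Rightarrow> 'a \<Rightarrow> real) \<Rightarrow> bool" where
  "irreducible_kernel K \<longleftrightarrow> (\<forall>x y. \<exists>n. 0 < kernel_power K n x y)"

definition invariant_prob :: "('a::finite \<Rightarrow> 'a \<Rightarrow> real) \<Rightarrow> ('a \<Rightarrow> real) \<Rightarrow> bool" where
  "invariant_prob K \<pi> \<longleftrightarrow> (\<forall>x. 0 \<le> \<pi> x) \<and> (\<Sum>x\<in>UNIV. \<pi> x) = 1 \<and>
     (\<forall>y. (\<Sum>x\<in>UNIV. \<pi> x * K x y) = \<pi> y)"

definition pi_star :: "('a::finite \<Rightarrow> real) \<Rightarrow> real" where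
  "pi_star \<pi> = Min (range \<pi>)"

definition heat_kernel :: "('a::finite \<Rightarrow> 'a \<Rightarrow> real) \<Rightarrow> real \<Rightarrow> 'a \<Rightarrow> 'a \<Rightarrow> real" where
  "heat_kernel K t x y = exp (- t) * (\<Sum>n. t ^ n / fact n * kernel_power K n x y)"

text \<open>Extended-valued, so that the infimum is \<open>\<infinity>\<close> if no time qualifies.\<close>

definition mixing_time_inf :: "('a::finite \<Rightarrow> 'a \<Rightarrow> real) \<Rightarrow> ('a \<Rightarrow> real) \<Rightarrow> real \<Rightarrow> ennreal" where
  "mixing_time_inf K \<pi> \<epsilon> =
     (INF t\<in>{t. 0 < t \<and> (SUP (x, y)\<in>UNIV. \<bar>(heat_kernel K t x y - \<pi> y) / \<pi> y\<bar>) \<le> \<epsilon>}. ennreal t)"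

definition dirichlet_form ::
    "('a::finite \<Rightarrow> 'a \<Rightarrow> real) \<Rightarrow> ('a \<Rightarrow> real) \<Rightarrow> ('a \<Rightarrow> real) \<Rightarrow> ('a \<Rightarrow> real) \<Rightarrow> real" where
  "dirichlet_form K \<pi> f g = (\<Sum>x\<in>UNIV. (f x - (\<Sum>y\<in>UNIV. K x y * f y)) * g x * \<pi> x)"

definition Var :: "('a::finite \<Rightarrow> real) \<Rightarrow> ('a \<Rightarrow> real) \<Rightarrow> real" where
  "Var \<pi> f = (\<Sum>x\<in>UNIV. (f x - (\<Sum>y\<in>UNIV. f y * \<pi> y))\<^sup>2 * \<pi> x)"

definition c0_plus :: "'a::finite set \<Rightarrow> ('a \<Rightarrow> real) set" where
  "c0_plus S = {f. {x. f x \<noteq> 0} \<subseteq> S \<and> (\<forall>x. 0 \<le> f x) \<and> \<not> (\<exists>c. \<forall>x. f x = c)}"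

text \<open>The quotient is cast to \<open>ennreal\<close> so that the infimum over the empty set, which occurs
  when the state space is a single point, is \<open>\<infinity>\<close>. The cast does not truncate, by
  \<open>dirichlet_form_nonneg\<close> and \<open>Var_nonneg\<close> below.\<close>

definition lambda_set ::
    "('a::finite \<Rightarrow> 'a \<Rightarrow> real) \<Rightarrow> ('a \<Rightarrow> real) \<Rightarrow> 'a set \<Rightarrow> ennreal" where
  "lambda_set K \<pi> S = (INF f\<in>c0_plus S. ennreal (dirichlet_form K \<pi> f f / Var \<pi> f))"

definition spectral_profile ::
    "('a::finite \<Rightarrow> 'a \<Rightarrow> real) \<Rightarrow> ('a \<Rightarrow> real) \<Rightarrow> real \<Rightarrow> ennreal" where
  "spectral_profile K \<pi> r =
     (INF S\<in>{S. S \<noteq> {} \<and> pi_star \<pi> \<le> sum \<pi> S \<and> sum \<pi> S \<le> r}. lambda_set K \<pi> S)"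

lemma Var_nonneg:
  assumes "invariant_prob K \<pi>"
  shows "0 \<le> Var \<pi> f"
  using assms by (auto simp: Var_def invariant_prob_def intro!: sum_nonneg)

lemma dirichlet_form_nonneg:
  assumes "markov_kernel K" "invariant_prob K \<pi>"
  shows "0 \<le> dirichlet_form K \<pi> f f"
proof -
  have K1: "(\<Sum>y\<in>UNIV. K x y) = 1" and K0: "0 \<le> K x y" for x y
    using assms by (auto simp: markov_kernel_def)
  have inv: "(\<Sum>x\<in>UNIV. \<pi> x * K x y) = \<pi> y" and p0: "0 \<le> \<pi> x" for x y
    using assms by (auto simp: invariant_prob_def)
  have A: "(\<Sum>x\<in>UNIV. \<Sum>y\<in>UNIV. \<pi> x * K x y * (f x)\<^sup>2) = (\<Sum>x\<in>UNIV. (f x)\<^sup>2 * \<pi> x)"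
    by (simp add: sum_distrib_left[symmetric] sum_distrib_right[symmetric] K1 mult.commute)
  have B: "(\<Sum>x\<in>UNIV. \<Sum>y\<in>UNIV. \<pi> x * K x y * (f y)\<^sup>2) = (\<Sum>x\<in>UNIV. (f x)\<^sup>2 * \<pi> x)"
    by (subst sum.swap) (simp add: sum_distrib_right[symmetric] inv mult.commute)
  have C: "(\<Sum>x\<in>UNIV. \<Sum>y\<in>UNIV. \<pi> x * K x y * (f x * f y))
      = (\<Sum>x\<in>UNIV. (\<Sum>y\<in>UNIV. K x y * f y) * f x * \<pi> x)"
    by (simp add: sum_distrib_left sum_distrib_right mult_ac)
  have D: "dirichlet_form K \<pi> f f = (\<Sum>x\<in>UNIV. (f x)\<^sup>2 * \<pi> x)
      - (\<Sum>x\<in>UNIV. (\<Sum>y\<in>UNIV. K x y * f y) * f x * \<pi> x)"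
    unfolding dirichlet_form_def sum_subtractf[symmetric]
    by (intro sum.cong refl) (simp add: algebra_simps power2_eq_square)
  have "(\<Sum>x\<in>UNIV. \<Sum>y\<in>UNIV. \<pi> x * K x y * (f x - f y)\<^sup>2)
     = (\<Sum>x\<in>UNIV. \<Sum>y\<in>UNIV. \<pi> x * K x y * (f x)\<^sup>2)
     + (\<Sum>x\<in>UNIV. \<Sum>y\<in>UNIV. \<pi> x * K x y * (f y)\<^sup>2)
     - 2 * (\<Sum>x\<in>UNIV. \<Sum>y\<in>UNIV. \<pi> x * K x y * (f x * f y))"
    unfolding sum_distrib_left sum.distrib[symmetric] sum_subtractf[symmetric]
    by (intro sum.cong refl) (simp add: algebra_simps power2_eq_square)
  also have "\<dots> = 2 * dirichlet_form K \<pi> f f"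
    using A B C D by simp
  finally show ?thesis
    using sum_nonneg[of UNIV "\<lambda>x. \<Sum>y\<in>UNIV. \<pi> x * K x y * (f x - f y)\<^sup>2"]
    by (simp add: sum_nonneg K0 p0)
qed

end

theory Submission
  imports Defs
begin

text \<open>Fix a target state \<open>y\<close>. The density \<open>h\<^sub>t(x) = H\<^sub>t(x,y) / \<pi>(y)\<close> has mean \<open>1\<close> and
  solves \<open>h' = -(I - K)h\<close>, so \<open>V(t) = Var h\<^sub>t\<close> satisfies \<open>V' = -2 \<E>(h\<^sub>t,h\<^sub>t)\<close>. The Dirichlet form
  of a non-negative function \<open>u\<close> is bounded below through the spectral profile by truncating at
  a level \<open>c\<close>: passing to the positive part of \<open>u - c\<close> does not increase the Dirichlet form, costs at
  most \<open>2c\<close> times the mean in variance, and by Markov's inequality leaves a function supported on a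
  set of measure at most the mean divided by \<open>c\<close>. The level that gives up half of the variance yields
  \<open>\<E>(u,u) \<ge> Var u / 2 \<cdot> \<Lambda>(4 (mean u)\<^sup>2 / Var u)\<close> (\<open>spectral_profile_le\<close>), hence
  \<open>V' \<le> -V \<Lambda>(4/V)\<close>.

  In terms of \<open>w = 4/V\<close> this reads \<open>w' \<ge> w \<Lambda>(w)\<close>. Integrating \<open>2 w' / (w \<Lambda>(w)) \<ge> 2\<close> over time and
  substituting \<open>v = w(s)\<close>, one finds that as long as \<open>V(t) > \<epsilon>\<close>, twice the elapsed time is
  at most the integral in the theorem: \<open>w\<close> starts at or above \<open>4\<pi>\<^sub>*\<close> because
  \<open>V(0) = 1/\<pi>(y) - 1\<close>, and is still below \<open>4/\<epsilon>\<close> (\<open>large_Var_time_le_integral\<close>).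

  The time reversal of \<open>K\<close> has the same Dirichlet form, hence the same spectral profile, so
  its densities obey the same bound. By the semigroup property the relative error of \<open>H\<^sub>2\<^sub>t\<close> at
  \<open>(x,y)\<close> is the inner product of the centred density of \<open>H\<^sub>t\<close> at \<open>y\<close> with the centred density
  of the reversed chain at \<open>x\<close>. It is therefore at most \<open>\<epsilon>\<close> once both variances are
  (\<open>heat_kernel_uniform_bound\<close>), and the doubling of time produces the factor \<open>2\<close> in the integrand.\<close>

abbreviation (input) mean :: "('a::finite \<Rightarrow> real) \<Rightarrow> ('a \<Rightarrow> real) \<Rightarrow> real" where
  "mean \<pi> f \<equiv> (\<Sum>x\<in>UNIV. f x * \<pi> x)"

definition time_reversal ::
    "('a::finite \<Rightarrow> 'a \<Rightarrow> real) \<Rightarrow> ('a \<Rightarrow> real) \<Rightarrow> 'a \<Rightarrow> 'a \<Rightarrow> real" where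
  "time_reversal K \<pi> x y = \<pi> y * K y x / \<pi> x"

section \<open>Variance and Dirichlet form under truncation\<close>

lemma Var_eq:
  assumes "sum \<pi> UNIV = 1"
  shows "Var \<pi> f = (\<Sum>x\<in>UNIV. (f x)\<^sup>2 * \<pi> x) - (mean \<pi> f)\<^sup>2"
proof -
  let ?m = "mean \<pi> f"
  have "Var \<pi> f = (\<Sum>x\<in>UNIV. (f x)\<^sup>2 * \<pi> x - 2 * ?m * (f x * \<pi> x) + ?m\<^sup>2 * \<pi> x)"
    unfolding Var_def by (intro sum.cong refl) (simp add: power2_eq_square algebra_simps)
  also have "\<dots> = (\<Sum>x\<in>UNIV. (f x)\<^sup>2 * \<pi> x) - 2 * ?m * ?m + ?m\<^sup>2 * sum \<pi> UNIV"
    by (simp only: sum.distrib sum_subtractf sum_distrib_left)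
  finally show ?thesis using assms by (simp add: power2_eq_square)
qed

text \<open>Stationarity makes both marginals of the edge measure \<open>\<pi>(x) K(x,y)\<close> equal to \<open>\<pi>\<close>, so
  that expanding the square on the right gives back the Dirichlet form. In this form monotonicity
  under contractions and invariance under time reversal are visible.\<close>

lemma dirichlet_form_edge_sum:
  assumes "markov_kernel K" "invariant_prob K \<pi>"
  shows "dirichlet_form K \<pi> f f
    = (\<Sum>x\<in>UNIV. \<Sum>y\<in>UNIV. \<pi> x * K x y * (f x - f y)\<^sup>2) / 2"
proof -
  have K1: "(\<Sum>y\<in>UNIV. K x y) = 1" for x
    using assms by (auto simp: markov_kernel_def)
  have inv: "(\<Sum>x\<in>UNIV. \<pi> x * K x y) = \<pi> y" for y
    using assms by (auto simp: invariant_prob_def)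
  have A: "(\<Sum>x\<in>UNIV. \<Sum>y\<in>UNIV. \<pi> x * K x y * (f x)\<^sup>2) = (\<Sum>x\<in>UNIV. (f x)\<^sup>2 * \<pi> x)"
    by (simp add: sum_distrib_left[symmetric] sum_distrib_right[symmetric] K1 mult.commute)
  have B: "(\<Sum>x\<in>UNIV. \<Sum>y\<in>UNIV. \<pi> x * K x y * (f y)\<^sup>2) = (\<Sum>x\<in>UNIV. (f x)\<^sup>2 * \<pi> x)"
    by (subst sum.swap) (simp add: sum_distrib_right[symmetric] inv mult.commute)
  have "(\<Sum>x\<in>UNIV. \<Sum>y\<in>UNIV. \<pi> x * K x y * (f x - f y)\<^sup>2)
     = (\<Sum>x\<in>UNIV. \<Sum>y\<in>UNIV. \<pi> x * K x y * (f x)\<^sup>2)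
     + (\<Sum>x\<in>UNIV. \<Sum>y\<in>UNIV. \<pi> x * K x y * (f y)\<^sup>2)
     - 2 * (\<Sum>x\<in>UNIV. \<Sum>y\<in>UNIV. \<pi> x * K x y * (f x * f y))"
    unfolding sum_distrib_left sum.distrib[symmetric] sum_subtractf[symmetric]
    by (intro sum.cong refl) (simp add: algebra_simps power2_eq_square)
  also have "\<dots> = 2 * (\<Sum>x\<in>UNIV. (f x)\<^sup>2 * \<pi> x
      - (\<Sum>y\<in>UNIV. \<pi> x * K x y * (f x * f y)))"
    by (simp only: A B sum_subtractf) simp
  also have "\<dots> = 2 * dirichlet_form K \<pi> f f"
    unfolding dirichlet_form_def
    by (intro arg_cong[where f="\<lambda>x. 2 * x"] sum.cong refl)
       (simp add: algebra_simps power2_eq_square sum_distrib_left sum_distrib_right)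
  finally show ?thesis by simp
qed

text \<open>The map \<open>a \<mapsto> max 0 (a - c)\<close> is a contraction, so every edge term of
  \<open>dirichlet_form_edge_sum\<close> decreases.\<close>

lemma dirichlet_form_truncate_le:
  assumes "markov_kernel K" "invariant_prob K \<pi>"
  shows "dirichlet_form K \<pi> (\<lambda>x. max 0 (u x - c)) (\<lambda>x. max 0 (u x - c))
    \<le> dirichlet_form K \<pi> u u"
  unfolding dirichlet_form_edge_sum[OF assms]
proof (intro divide_right_mono sum_mono mult_left_mono)
  fix x y
  show "(max 0 (u x - c) - max 0 (u y - c))\<^sup>2 \<le> (u x - u y)\<^sup>2"
    by (rule abs_le_square_iff[THEN iffD1]) (auto simp: max_def)
  show "0 \<le> \<pi> x * K x y"
    using assms by (simp add: markov_kernel_def invariant_prob_def)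
qed simp

text \<open>Pointwise, the square of the positive part of \<open>u - c\<close> is at least \<open>u\<^sup>2 - 2cu\<close> (below the
  level \<open>c\<close> the latter is non-positive), while truncation does not increase the mean.\<close>

lemma Var_truncate_ge:
  assumes "\<And>x. 0 \<le> \<pi> x" "sum \<pi> UNIV = 1" "\<And>x. 0 \<le> u x" "0 \<le> c"
  shows "Var \<pi> u - 2 * c * mean \<pi> u \<le> Var \<pi> (\<lambda>x. max 0 (u x - c))"
proof -
  let ?f = "\<lambda>x. max 0 (u x - c)"
  have "(\<Sum>x\<in>UNIV. (u x)\<^sup>2 * \<pi> x) - 2 * c * mean \<pi> u
      = (\<Sum>x\<in>UNIV. ((u x)\<^sup>2 - 2 * c * u x) * \<pi> x)"
    by (simp add: sum_distrib_left sum_subtractf algebra_simps)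
  also have "\<dots> \<le> (\<Sum>x\<in>UNIV. (?f x)\<^sup>2 * \<pi> x)"
  proof (intro sum_mono mult_right_mono assms(1))
    fix x
    show "(u x)\<^sup>2 - 2 * c * u x \<le> (?f x)\<^sup>2"
    proof (cases "u x \<le> c")
      case True
      have "u x * u x \<le> 2 * c * u x"
        using True assms(3)[of x] assms(4) by (intro mult_right_mono) auto
      with True show ?thesis by (simp add: power2_eq_square max_def)
    qed (simp add: power2_eq_square algebra_simps)
  qed
  finally have 1: "(\<Sum>x\<in>UNIV. (u x)\<^sup>2 * \<pi> x) - 2 * c * mean \<pi> u
    \<le> (\<Sum>x\<in>UNIV. (?f x)\<^sup>2 * \<pi> x)" .
  have "0 \<le> mean \<pi> ?f" "mean \<pi> ?f \<le> mean \<pi> u"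
    using assms by (auto intro!: sum_nonneg sum_mono mult_right_mono)
  then have "(mean \<pi> ?f)\<^sup>2 \<le> (mean \<pi> u)\<^sup>2"
    by (rule power_mono[rotated])
  with 1 show ?thesis
    by (simp add: Var_eq[OF assms(2)])
qed

text \<open>The Faber-Krahn type inequality behind the theorem. The admissible test function in the
  definition of the spectral profile is the positive part of \<open>u - c\<close>.\<close>

lemma spectral_profile_le:
  assumes "markov_kernel K" "invariant_prob K \<pi>"
    and u: "\<And>x. 0 \<le> u x" and m: "0 < mean \<pi> u" and V: "0 < Var \<pi> u"
  shows "spectral_profile K \<pi> (4 * (mean \<pi> u)\<^sup>2 / Var \<pi> u)
    \<le> ennreal (2 * dirichlet_form K \<pi> u u / Var \<pi> u)"
proof -
  have p0: "0 \<le> \<pi> x" and p1: "sum \<pi> UNIV = 1" for x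
    using assms(2) by (auto simp: invariant_prob_def)
  \<comment> \<open>Truncation costs at most \<open>2c\<close> times the mean, which this level makes equal to half the variance.\<close>
  define c where "c = Var \<pi> u / (4 * mean \<pi> u)"
  define f where "f = (\<lambda>x. max 0 (u x - c))"
  define S where "S = {x. u x > c}"
  have c0: "0 < c" using m V by (simp add: c_def)
  have "Var \<pi> u / 2 = Var \<pi> u - 2 * c * mean \<pi> u"
    using m by (simp add: c_def)
  also have "\<dots> \<le> Var \<pi> f"
    unfolding f_def using c0 by (intro Var_truncate_ge p0 p1 u) simp
  finally have Vf: "Var \<pi> u / 2 \<le> Var \<pi> f" .
  \<comment> \<open>Positivity of the variance shows that \<open>f\<close> is a legitimate test function and \<open>S\<close> is non-empty.\<close>
  have nc: "\<not> (\<exists>a. \<forall>x. f x = a)"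
  proof
    assume "\<exists>a. \<forall>x. f x = a"
    then obtain a where "f = (\<lambda>x. a)" by auto
    then have "Var \<pi> f = 0"
      by (simp add: Var_def sum_distrib_left[symmetric] p1)
    with Vf V show False by simp
  qed
  then obtain x where x: "x \<in> S"
    unfolding f_def S_def by (metis mem_Collect_eq diff_gt_0_iff_gt max.absorb1 not_less)
  have fc: "f \<in> c0_plus S"
    using nc by (auto simp: c0_plus_def f_def S_def)
  have "pi_star \<pi> \<le> \<pi> x" by (simp add: pi_star_def)
  also have "\<pi> x \<le> sum \<pi> S" using x p0 by (intro member_le_sum) auto
  finally have S1: "pi_star \<pi> \<le> sum \<pi> S" .
  \<comment> \<open>Markov's inequality bounds the measure of the support.\<close>
  have "c * sum \<pi> S = (\<Sum>x\<in>S. c * \<pi> x)" by (simp add: sum_distrib_left)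
  also have "\<dots> \<le> (\<Sum>x\<in>S. u x * \<pi> x)"
    by (intro sum_mono mult_right_mono p0) (simp add: S_def)
  also have "\<dots> \<le> mean \<pi> u" by (intro sum_mono2) (auto simp: u p0)
  finally have "c * sum \<pi> S \<le> mean \<pi> u" .
  then have S2: "sum \<pi> S \<le> 4 * (mean \<pi> u)\<^sup>2 / Var \<pi> u"
    using m V by (simp add: c_def field_simps power2_eq_square)
  have "spectral_profile K \<pi> (4 * (mean \<pi> u)\<^sup>2 / Var \<pi> u) \<le> lambda_set K \<pi> S"
    unfolding spectral_profile_def using S1 S2 x by (intro INF_lower) auto
  also have "\<dots> \<le> ennreal (dirichlet_form K \<pi> f f / Var \<pi> f)"
    unfolding lambda_set_def using fc by (rule INF_lower)
  also have "\<dots> \<le> ennreal (dirichlet_form K \<pi> u u / (Var \<pi> u / 2))"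
    using Vf V dirichlet_form_truncate_le[OF assms(1,2)] dirichlet_form_nonneg[OF assms(1,2)]
    unfolding f_def by (intro ennreal_leI frac_le) auto
  finally show ?thesis by (simp add: mult.commute)
qed

lemma spectral_profile_antimono:
  assumes "r \<le> s"
  shows "spectral_profile K \<pi> s \<le> spectral_profile K \<pi> r"
  unfolding spectral_profile_def using assms by (intro INF_superset_mono) auto

text \<open>Moving the constraint \<open>\<pi>(S) \<le> r\<close> into the function turns the profile into an infimum, over
  a finite family independent of \<open>r\<close>, of step functions.\<close>

lemma borel_measurable_spectral_profile [measurable]:
  "spectral_profile K \<pi> \<in> borel_measurable borel"
proof -
  let ?A = "{S. S \<noteq> {} \<and> pi_star \<pi> \<le> sum \<pi> S}"
  let ?B = "\<lambda>r. {S. S \<noteq> {} \<and> pi_star \<pi> \<le> sum \<pi> S \<and> sum \<pi> S \<le> r}"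
  have "spectral_profile K \<pi> r = (INF S\<in>?A. if sum \<pi> S \<le> r then lambda_set K \<pi> S else top)" for r
    unfolding spectral_profile_def
  proof (rule antisym)
    show "(INF S\<in>?B r. lambda_set K \<pi> S)
        \<le> (INF S\<in>?A. if sum \<pi> S \<le> r then lambda_set K \<pi> S else top)"
    proof (rule INF_greatest)
      fix S assume "S \<in> ?A"
      then show "(INF S\<in>?B r. lambda_set K \<pi> S)
          \<le> (if sum \<pi> S \<le> r then lambda_set K \<pi> S else top)"
        using INF_lower[of S "?B r" "lambda_set K \<pi>"] by simp
    qed
    show "(INF S\<in>?A. if sum \<pi> S \<le> r then lambda_set K \<pi> S else top)
        \<le> (INF S\<in>?B r. lambda_set K \<pi> S)"
    proof (rule INF_greatest)
      fix S assume "S \<in> ?B r"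
      then show "(INF S\<in>?A. if sum \<pi> S \<le> r then lambda_set K \<pi> S else top) \<le> lambda_set K \<pi> S"
        using INF_lower[of S ?A "\<lambda>S. if sum \<pi> S \<le> r then lambda_set K \<pi> S else top"] by simp
    qed
  qed
  then have "spectral_profile K \<pi>
      = (\<lambda>r. INF S\<in>?A. if sum \<pi> S \<le> r then lambda_set K \<pi> S else top)" by blast
  also have "\<dots> \<in> borel_measurable borel"
    by (intro borel_measurable_INF countable_finite) auto
  finally show ?thesis .
qed

section \<open>Powers of the kernel and the heat semigroup\<close>

lemma kernel_power_nonneg:
  assumes "markov_kernel K"
  shows "0 \<le> kernel_power K n x y"
  using assms by (induction n arbitrary: x) (auto simp: markov_kernel_def intro!: sum_nonneg)

lemma kernel_power_le_1:
  assumes "markov_kernel K"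
  shows "kernel_power K n x y \<le> 1"
proof (induction n arbitrary: x)
  case (Suc n)
  have "kernel_power K (Suc n) x y \<le> (\<Sum>z\<in>UNIV. K x z * 1)"
    unfolding kernel_power.simps
    using assms Suc by (intro sum_mono mult_left_mono) (auto simp: markov_kernel_def)
  with assms show ?case by (simp add: markov_kernel_def)
qed simp

lemma kernel_power_add:
  "kernel_power K (m + n) x y = (\<Sum>z\<in>UNIV. kernel_power K m x z * kernel_power K n z y)"
proof (induction m arbitrary: x)
  case 0
  have "(\<Sum>z\<in>UNIV. kernel_power K 0 x z * kernel_power K n z y)
      = (\<Sum>z\<in>UNIV. if x = z then kernel_power K n z y else 0)"
    by (intro sum.cong) auto
  then show ?case by simp
next
  case (Suc m)
  have "kernel_power K (Suc m + n) x y
      = (\<Sum>w\<in>UNIV. \<Sum>z\<in>UNIV. K x w * (kernel_power K m w z * kernel_power K n z y))"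
    by (simp add: Suc sum_distrib_left)
  also have "\<dots> = (\<Sum>z\<in>UNIV. kernel_power K (Suc m) x z * kernel_power K n z y)"
    by (subst sum.swap) (simp add: sum_distrib_right mult.assoc)
  finally show ?case .
qed

lemma kernel_power_Suc_right:
  "kernel_power K (Suc n) x y = (\<Sum>z\<in>UNIV. kernel_power K n x z * K z y)"
proof -
  have "kernel_power K (Suc 0) z y = K z y" for z
  proof -
    have "kernel_power K (Suc 0) z y = (\<Sum>w\<in>UNIV. if w = y then K z w else 0)"
      unfolding kernel_power.simps by (intro sum.cong) auto
    then show ?thesis by simp
  qed
  then show ?thesis
    using kernel_power_add[of K n "Suc 0" x y] by (simp del: kernel_power.simps)
qed

lemma kernel_power_invariant:
  assumes "invariant_prob K \<pi>"
  shows "(\<Sum>x\<in>UNIV. \<pi> x * kernel_power K n x y) = \<pi> y"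
proof (induction n)
  case 0
  have "(\<Sum>x\<in>UNIV. \<pi> x * kernel_power K 0 x y) = (\<Sum>x\<in>UNIV. if x = y then \<pi> x else 0)"
    by (intro sum.cong) auto
  then show ?case by simp
next
  case (Suc n)
  have "(\<Sum>x\<in>UNIV. \<pi> x * kernel_power K (Suc n) x y)
      = (\<Sum>z\<in>UNIV. \<Sum>x\<in>UNIV. \<pi> x * K x z * kernel_power K n z y)"
    by (subst sum.swap) (simp add: sum_distrib_left mult.assoc)
  also have "\<dots> = (\<Sum>z\<in>UNIV. \<pi> z * kernel_power K n z y)"
    using assms by (simp add: invariant_prob_def sum_distrib_right[symmetric])
  finally show ?case using Suc by simp
qed

text \<open>Some state has positive mass, and by irreducibility a power of \<open>K\<close>, which also preserves
  \<open>\<pi>\<close>, transports part of it to \<open>y\<close>.\<close>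

lemma invariant_prob_pos:
  assumes "markov_kernel K" "irreducible_kernel K" "invariant_prob K \<pi>"
  shows "0 < \<pi> y"
proof -
  have p0: "0 \<le> \<pi> x" and p1: "sum \<pi> UNIV = 1" for x
    using assms(3) by (auto simp: invariant_prob_def)
  obtain x where "\<pi> x \<noteq> 0" using p1 by (metis sum.neutral zero_neq_one)
  with p0[of x] have x: "0 < \<pi> x" by simp
  obtain n where n: "0 < kernel_power K n x y"
    using assms(2) by (auto simp: irreducible_kernel_def)
  have "0 < \<pi> x * kernel_power K n x y" using x n by simp
  also have "\<dots> \<le> (\<Sum>x\<in>UNIV. \<pi> x * kernel_power K n x y)"
    using p0 kernel_power_nonneg[OF assms(1)] by (intro member_le_sum) auto
  finally show ?thesis using kernel_power_invariant[OF assms(3)] by simp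
qed

lemma summable_heat_kernel:
  assumes "markov_kernel K"
  shows "summable (\<lambda>n. norm (t ^ n / fact n * kernel_power K n x y))"
proof (rule summable_comparison_test')
  show "summable (\<lambda>n. inverse (fact n) * \<bar>t\<bar> ^ n)" by (rule summable_exp)
  fix n :: nat
  have "\<bar>t\<bar> ^ n / fact n * \<bar>kernel_power K n x y\<bar> \<le> \<bar>t\<bar> ^ n / fact n * 1"
    using kernel_power_nonneg[OF assms, of n x y] kernel_power_le_1[OF assms, of n x y]
    by (intro mult_left_mono) auto
  then show "norm (norm (t ^ n / fact n * kernel_power K n x y)) \<le> inverse (fact n) * \<bar>t\<bar> ^ n"
    by (simp add: abs_mult power_abs field_simps)
qed

lemma heat_kernel_sums:
  assumes "markov_kernel K"
  shows "(\<lambda>n. exp (- t) * (t ^ n / fact n * kernel_power K n x y)) sums heat_kernel K t x y"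
  unfolding heat_kernel_def
  by (intro sums_mult summable_sums summable_norm_cancel[OF summable_heat_kernel[OF assms]])

lemma heat_kernel_nonneg:
  assumes "markov_kernel K" "0 \<le> t"
  shows "0 \<le> heat_kernel K t x y"
  unfolding heat_kernel_def
proof (rule mult_nonneg_nonneg[OF _ suminf_nonneg])
  show "summable (\<lambda>n. t ^ n / fact n * kernel_power K n x y)"
    by (rule summable_norm_cancel[OF summable_heat_kernel[OF assms(1)]])
  show "0 \<le> t ^ n / fact n * kernel_power K n x y" for n
    using assms(2) kernel_power_nonneg[OF assms(1)] by simp
qed simp

lemma exp_weights_sums: "(\<lambda>n. exp (- t) * (t ^ n / fact n)) sums (1::real)"
proof -
  have "(\<lambda>n. exp (- t) * (t ^ n / fact n)) sums (exp (- t) * exp t)"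
    using exp_converges[of t] by (intro sums_mult) (simp add: field_simps)
  then show ?thesis by (simp add: exp_minus)
qed

lemma heat_kernel_0: "heat_kernel K 0 x y = (if x = y then 1 else 0)"
  using powser_zero[of "\<lambda>n. kernel_power K n x y / fact n"]
  by (simp add: heat_kernel_def mult.commute)

lemma heat_kernel_invariant:
  assumes "markov_kernel K" "invariant_prob K \<pi>"
  shows "(\<Sum>x\<in>UNIV. \<pi> x * heat_kernel K t x y) = \<pi> y"
proof (rule sums_unique2)
  have "(\<lambda>n. \<Sum>x\<in>UNIV. \<pi> x * (exp (- t) * (t ^ n / fact n * kernel_power K n x y)))
      sums (\<Sum>x\<in>UNIV. \<pi> x * heat_kernel K t x y)"
    by (intro sums_sum sums_mult heat_kernel_sums assms)
  also have "(\<lambda>n. \<Sum>x\<in>UNIV. \<pi> x * (exp (- t) * (t ^ n / fact n * kernel_power K n x y)))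
      = (\<lambda>n. exp (- t) * (t ^ n / fact n) * (\<Sum>x\<in>UNIV. \<pi> x * kernel_power K n x y))"
    by (simp add: sum_distrib_left mult_ac)
  also have "\<dots> = (\<lambda>n. exp (- t) * (t ^ n / fact n) * \<pi> y)"
    by (simp add: kernel_power_invariant[OF assms(2)])
  finally show "(\<lambda>n. exp (- t) * (t ^ n / fact n) * \<pi> y)
      sums (\<Sum>x\<in>UNIV. \<pi> x * heat_kernel K t x y)" .
  show "(\<lambda>n. exp (- t) * (t ^ n / fact n) * \<pi> y) sums \<pi> y"
    using sums_mult2[OF exp_weights_sums[of t], of "\<pi> y"] by simp
qed

text \<open>The backward equation \<open>H' = -(I - K)H\<close>: differentiating the exponential series term by term
  shifts the powers of \<open>K\<close> by one.\<close>

lemma heat_kernel_deriv: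
  assumes "markov_kernel K"
  shows "((\<lambda>t. heat_kernel K t x y) has_real_derivative
    (\<Sum>z\<in>UNIV. K x z * heat_kernel K t z y) - heat_kernel K t x y) (at t)"
proof -
  define c where "c = (\<lambda>z n. kernel_power K n z y / fact n)"
  have eq: "t ^ n / fact n * kernel_power K n z y = c z n * t ^ n" for t n z
    by (simp add: c_def)
  have sm: "summable (\<lambda>n. c z n * t ^ n)" for t z
    unfolding eq[symmetric] by (rule summable_norm_cancel[OF summable_heat_kernel[OF assms]])
  have D: "((\<lambda>t. \<Sum>n. c x n * t ^ n) has_real_derivative (\<Sum>n. diffs (c x) n * t ^ n)) (at t)"
    by (rule termdiffs_strong_converges_everywhere) (rule sm)
  have "diffs (c x) n = (\<Sum>z\<in>UNIV. K x z * c z n)" for n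
    by (simp add: diffs_def c_def sum_distrib_left sum_divide_distrib field_simps del: of_nat_Suc)
  then have "(\<Sum>n. diffs (c x) n * t ^ n) = (\<Sum>n. \<Sum>z\<in>UNIV. K x z * (c z n * t ^ n))"
    by (simp add: sum_distrib_right mult.assoc)
  also have "\<dots> = (\<Sum>z\<in>UNIV. K x z * (\<Sum>n. c z n * t ^ n))"
    by (subst suminf_sum) (auto intro!: sum.cong summable_mult sm suminf_mult)
  finally have "(\<Sum>n. diffs (c x) n * t ^ n) = (\<Sum>z\<in>UNIV. K x z * (\<Sum>n. c z n * t ^ n))" .
  with D have D': "((\<lambda>t. \<Sum>n. c x n * t ^ n) has_real_derivative
      (\<Sum>z\<in>UNIV. K x z * (\<Sum>n. c z n * t ^ n))) (at t)" by simp
  show ?thesis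
    unfolding heat_kernel_def eq
    by (rule derivative_eq_intros D' refl)+
       (simp add: algebra_simps sum_distrib_left)
qed

text \<open>The Cauchy product of the two exponential series, combined with the binomial theorem.\<close>

lemma heat_kernel_add:
  assumes "markov_kernel K"
  shows "heat_kernel K (s + t) x y = (\<Sum>z\<in>UNIV. heat_kernel K s x z * heat_kernel K t z y)"
proof -
  let ?a = "\<lambda>z i. s ^ i / fact i * kernel_power K i x z"
  let ?b = "\<lambda>z i. t ^ i / fact i * kernel_power K i z y"
  have "(\<lambda>n. \<Sum>z\<in>UNIV. \<Sum>i\<le>n. ?a z i * ?b z (n - i))
      sums (\<Sum>z\<in>UNIV. (\<Sum>n. ?a z n) * (\<Sum>n. ?b z n))"
    by (intro sums_sum Cauchy_product_sums summable_heat_kernel assms)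
  also have "(\<lambda>n. \<Sum>z\<in>UNIV. \<Sum>i\<le>n. ?a z i * ?b z (n - i))
      = (\<lambda>n. (s + t) ^ n / fact n * kernel_power K n x y)"
  proof
    fix n
    have "(\<Sum>z\<in>UNIV. \<Sum>i\<le>n. ?a z i * ?b z (n - i))
        = (\<Sum>i\<le>n. s ^ i / fact i * (t ^ (n - i) / fact (n - i)) *
            (\<Sum>z\<in>UNIV. kernel_power K i x z * kernel_power K (n - i) z y))"
      by (subst sum.swap) (simp add: sum_distrib_left sum_divide_distrib mult_ac)
    also have "\<dots> = (\<Sum>i\<le>n. of_nat (n choose i) * s ^ i * t ^ (n - i) / fact n
        * kernel_power K n x y)"
      by (intro sum.cong refl) (simp add: kernel_power_add[symmetric] binomial_fact)
    also have "\<dots> = (s + t) ^ n / fact n * kernel_power K n x y"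
      by (simp add: binomial_ring sum_distrib_right sum_divide_distrib)
    finally show "(\<Sum>z\<in>UNIV. \<Sum>i\<le>n. ?a z i * ?b z (n - i))
        = (s + t) ^ n / fact n * kernel_power K n x y" .
  qed
  finally have "(\<Sum>n. (s + t) ^ n / fact n * kernel_power K n x y)
      = (\<Sum>z\<in>UNIV. (\<Sum>n. ?a z n) * (\<Sum>n. ?b z n))" by (simp add: sums_iff)
  then show ?thesis
    unfolding heat_kernel_def minus_add_distrib exp_add sum_distrib_left
    by (simp only: sum_distrib_left mult_ac)
qed

section \<open>Time reversal\<close>

lemma time_reversal_markov:
  assumes "markov_kernel K" "invariant_prob K \<pi>" "\<And>x. 0 < \<pi> x"
  shows "markov_kernel (time_reversal K \<pi>)"
proof -
  have "(\<Sum>y\<in>UNIV. \<pi> y * K y x / \<pi> x) = 1" for x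
    using assms(2) assms(3)[of x] by (simp add: invariant_prob_def sum_divide_distrib[symmetric])
  then show ?thesis
    using assms(1) less_imp_le[OF assms(3)] by (simp add: markov_kernel_def time_reversal_def)
qed

lemma time_reversal_invariant:
  assumes "markov_kernel K" "invariant_prob K \<pi>" "\<And>x. 0 < \<pi> x"
  shows "invariant_prob (time_reversal K \<pi>) \<pi>"
proof -
  have "\<pi> x * (\<pi> y * K y x / \<pi> x) = \<pi> y * K y x" for x y
    using assms(3)[of x] by simp
  then show ?thesis
    using assms(1,2)
    by (simp add: invariant_prob_def markov_kernel_def time_reversal_def sum_distrib_left[symmetric])
qed

text \<open>Reversal swaps the two endpoints in the edge measure, and \<open>(f(x) - f(y))\<^sup>2\<close> is symmetric.\<close>

lemma dirichlet_form_time_reversal: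
  assumes "markov_kernel K" "invariant_prob K \<pi>" "\<And>x. 0 < \<pi> x"
  shows "dirichlet_form (time_reversal K \<pi>) \<pi> f f = dirichlet_form K \<pi> f f"
proof -
  have "(\<Sum>x\<in>UNIV. \<Sum>y\<in>UNIV. \<pi> x * time_reversal K \<pi> x y * (f x - f y)\<^sup>2)
      = (\<Sum>x\<in>UNIV. \<Sum>y\<in>UNIV. \<pi> y * K y x * (f y - f x)\<^sup>2)"
    using assms(3) by (intro sum.cong refl) (simp add: time_reversal_def less_imp_neq[symmetric] power2_commute)
  also have "\<dots> = (\<Sum>x\<in>UNIV. \<Sum>y\<in>UNIV. \<pi> x * K x y * (f x - f y)\<^sup>2)"
    by (rule sum.swap)
  finally show ?thesis
    unfolding dirichlet_form_edge_sum[OF assms(1,2)]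
      dirichlet_form_edge_sum[OF time_reversal_markov[OF assms] time_reversal_invariant[OF assms]]
    by simp
qed

lemma spectral_profile_time_reversal:
  assumes "markov_kernel K" "invariant_prob K \<pi>" "\<And>x. 0 < \<pi> x"
  shows "spectral_profile (time_reversal K \<pi>) \<pi> = spectral_profile K \<pi>"
  by (simp add: fun_eq_iff spectral_profile_def lambda_set_def dirichlet_form_time_reversal[OF assms])

lemma kernel_power_time_reversal:
  assumes "\<And>x. 0 < \<pi> x"
  shows "kernel_power (time_reversal K \<pi>) n x y = \<pi> y * kernel_power K n y x / \<pi> x"
proof (induction n arbitrary: x)
  case 0
  then show ?case using assms[of x] by auto
next
  case (Suc n)
  have "kernel_power (time_reversal K \<pi>) (Suc n) x y
      = (\<Sum>z\<in>UNIV. \<pi> y * (kernel_power K n y z * K z x) / \<pi> x)"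
    using assms by (simp add: Suc) (simp add: time_reversal_def less_imp_neq[symmetric] mult_ac)
  also have "\<dots> = \<pi> y * kernel_power K (Suc n) y x / \<pi> x"
    by (simp add: kernel_power_Suc_right sum_distrib_left sum_divide_distrib
        del: kernel_power.simps)
  finally show ?case .
qed

lemma heat_kernel_time_reversal:
  assumes "markov_kernel K" "\<And>x. 0 < \<pi> x"
  shows "heat_kernel (time_reversal K \<pi>) t x y = \<pi> y * heat_kernel K t y x / \<pi> x"
proof -
  have "(\<lambda>n. (\<pi> y / \<pi> x) * (exp (- t) * (t ^ n / fact n * kernel_power K n y x)))
      sums ((\<pi> y / \<pi> x) * heat_kernel K t y x)"
    by (intro sums_mult heat_kernel_sums assms)
  then have "(\<lambda>n. exp (- t) * (t ^ n / fact n * kernel_power (time_reversal K \<pi>) n x y))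
      sums ((\<pi> y / \<pi> x) * heat_kernel K t y x)"
    by (simp add: kernel_power_time_reversal[OF assms(2)] mult_ac)
  then have "(\<Sum>n. t ^ n / fact n * kernel_power (time_reversal K \<pi>) n x y)
      = exp t * ((\<pi> y / \<pi> x) * heat_kernel K t y x)"
    using sums_mult[of "\<lambda>n. exp (- t) * (t ^ n / fact n * kernel_power (time_reversal K \<pi>) n x y)" _ "exp t"]
    by (simp add: sums_iff mult.assoc[symmetric] exp_add[symmetric])
  then show ?thesis
    by (simp add: heat_kernel_def[of "time_reversal K \<pi>"] mult.assoc[symmetric] exp_add[symmetric])
qed

section \<open>Decay of the variance of the heat kernel density\<close>

text \<open>The density is read as a function of the starting point \<open>x\<close>, with the target \<open>y\<close> fixed,
  so that it evolves by \<open>K\<close> itself. The density in the other variable is the one of the time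
  reversal, by \<open>heat_kernel_time_reversal\<close>.\<close>

definition heat_density ::
    "('a::finite \<Rightarrow> 'a \<Rightarrow> real) \<Rightarrow> ('a \<Rightarrow> real) \<Rightarrow> 'a \<Rightarrow> real \<Rightarrow> 'a \<Rightarrow> real" where
  "heat_density K \<pi> y t x = heat_kernel K t x y / \<pi> y"

lemma heat_density_mean:
  assumes "markov_kernel K" "invariant_prob K \<pi>" "\<And>x. 0 < \<pi> x"
  shows "mean \<pi> (heat_density K \<pi> y t) = 1"
  using heat_kernel_invariant[OF assms(1,2), of t y] assms(3)[of y]
  by (simp add: heat_density_def sum_divide_distrib[symmetric] mult.commute)

lemma heat_density_deriv:
  assumes "markov_kernel K"
  shows "((\<lambda>t. heat_density K \<pi> y t x) has_real_derivative
    (\<Sum>z\<in>UNIV. K x z * heat_density K \<pi> y t z) - heat_density K \<pi> y t x) (at t)"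
  unfolding heat_density_def
  by (rule DERIV_cong[OF DERIV_cdivide[OF heat_kernel_deriv[OF assms]]])
     (simp add: diff_divide_distrib sum_divide_distrib)

text \<open>As the mean is constant in time, only the second moment contributes.\<close>

lemma Var_heat_density_deriv:
  assumes "markov_kernel K" "invariant_prob K \<pi>" "\<And>x. 0 < \<pi> x"
  shows "((\<lambda>t. Var \<pi> (heat_density K \<pi> y t)) has_real_derivative
    - 2 * dirichlet_form K \<pi> (heat_density K \<pi> y t) (heat_density K \<pi> y t)) (at t)"
proof -
  have p1: "sum \<pi> UNIV = 1" using assms(2) by (simp add: invariant_prob_def)
  show ?thesis
    unfolding Var_eq[OF p1] heat_density_mean[OF assms] dirichlet_form_def
    by (rule derivative_eq_intros heat_density_deriv[OF assms(1)] refl)+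
       (simp add: sum_distrib_left algebra_simps sum_negf sum_subtractf)
qed

lemma Var_heat_density_0:
  assumes "markov_kernel K" "invariant_prob K \<pi>" "\<And>x. 0 < \<pi> x"
  shows "Var \<pi> (heat_density K \<pi> y 0) = 1 / \<pi> y - 1"
proof -
  have p1: "sum \<pi> UNIV = 1" using assms(2) by (simp add: invariant_prob_def)
  have "(\<Sum>x\<in>UNIV. (heat_density K \<pi> y 0 x)\<^sup>2 * \<pi> x) = (\<Sum>x\<in>UNIV. if x = y then 1 / \<pi> y else 0)"
    using assms(3)[of y]
    by (intro sum.cong) (auto simp: heat_density_def heat_kernel_0 power2_eq_square)
  then show ?thesis
    by (simp add: Var_eq[OF p1] heat_density_mean[OF assms])
qed

text \<open>The profile is antitone, so if it vanished at \<open>v\<close> the integrand would be infinite on all of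
  \<open>[v, b]\<close>. This lets the differential inequality be divided by the profile without first
  establishing a spectral gap.\<close>

lemma spectral_profile_nonzero_if_integral_finite:
  assumes "a \<le> v" "v < b"
    and fin: "(\<integral>\<^sup>+ v\<in>{a..b}. 2 / (ennreal v * spectral_profile K \<pi> v) \<partial>lborel) \<noteq> \<infinity>"
  shows "spectral_profile K \<pi> v \<noteq> 0"
proof
  assume 0: "spectral_profile K \<pi> v = 0"
  have Z: "spectral_profile K \<pi> r = 0" if "v \<le> r" for r
    using spectral_profile_antimono[OF that, of K \<pi>] 0 by simp
  have "\<infinity> = (\<integral>\<^sup>+ r. \<infinity> * indicator {v..b} r \<partial>lborel)"
    using assms by (subst nn_integral_cmult_indicator) (auto simp: ennreal_top_mult)
  also have "\<dots> \<le> (\<integral>\<^sup>+ v\<in>{a..b}. 2 / (ennreal v * spectral_profile K \<pi> v) \<partial>lborel)"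
    using assms by (intro nn_integral_mono) (auto simp: indicator_def Z)
  finally show False using fin by (simp add: top_unique)
qed

text \<open>The differential inequality \<open>w' \<ge> w \<Lambda>(w)\<close> for \<open>w = 4/V\<close>, integrated by substitution. The
  substitution requires continuity only of \<open>w'\<close>; the discontinuous profile enters merely as
  a measurable integrand.\<close>

lemma large_Var_time_le_integral:
  assumes K: "markov_kernel K" "invariant_prob K \<pi>" "\<And>x. 0 < \<pi> x"
    and e: "0 < e" and t: "0 \<le> t" and large: "e < Var \<pi> (heat_density K \<pi> y t)"
  shows "ennreal (2 * t)
    \<le> (\<integral>\<^sup>+ v\<in>{4 * pi_star \<pi>..4 / e}. 2 / (ennreal v * spectral_profile K \<pi> v) \<partial>lborel)"
    (is "_ \<le> ?I")
proof (cases "?I = \<infinity>")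
  case False
  define h where "h = heat_density K \<pi> y"
  define V where "V = (\<lambda>s. Var \<pi> (h s))"
  define E where "E = (\<lambda>s. dirichlet_form K \<pi> (h s) (h s))"
  define w where "w = (\<lambda>s. 4 / V s)"
  define w' where "w' = (\<lambda>s. 8 * E s / (V s)\<^sup>2)"
  \<comment> \<open>The substitution rule needs a real integrand. \<open>enn2real\<close> sends \<open>\<infinity>\<close> to \<open>0\<close>, so \<open>F\<close> never exceeds
    the original integrand; along \<open>w\<close> the two agree.\<close>
  define F where "F = (\<lambda>v. enn2real (2 / (ennreal v * spectral_profile K \<pi> v)))"
  have dV: "(V has_real_derivative - 2 * E s) (at s)" for s
    using Var_heat_density_deriv[OF K] by (simp add: V_def E_def h_def)
  have E0: "0 \<le> E s" for s
    unfolding E_def by (rule dirichlet_form_nonneg[OF K(1,2)])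
  have mono: "V b \<le> V a" if "a \<le> b" for a b
    using that by (rule DERIV_nonpos_imp_nonincreasing) (use dV E0 in \<open>auto intro!: exI[where x="- 2 * E _"]\<close>)
  have Ve: "e < V s" if "s \<le> t" for s
    using mono[OF that] large by (simp add: V_def h_def)
  have ps: "0 < pi_star \<pi>"
    unfolding pi_star_def using K(3) by (subst Min_gr_iff) auto
  have "V 0 \<le> 1 / pi_star \<pi>"
  proof -
    have "1 / \<pi> y \<le> 1 / pi_star \<pi>"
      using ps by (intro divide_left_mono) (auto simp: pi_star_def K(3))
    then show ?thesis
      by (simp add: V_def h_def Var_heat_density_0[OF K])
  qed
  then have w0: "4 * pi_star \<pi> \<le> w 0"
    using Ve[OF t] e ps by (simp add: w_def field_simps)
  have wt: "w s < 4 / e" if "s \<le> t" for s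
    using Ve[OF that] e by (simp add: w_def field_simps)
  have w_mono: "w 0 \<le> w s" if "0 \<le> s" "s \<le> t" for s
    using mono[OF that(1)] Ve[OF that(2)] e by (simp add: w_def frac_le)
  have dw: "(w has_real_derivative w' s) (at s)" if "s \<le> t" for s
    unfolding w_def w'_def using Ve[OF that] e
    by (auto intro!: derivative_eq_intros dV simp: power2_eq_square)
  have cE: "continuous_on {0..t} E"
    unfolding E_def dirichlet_form_def h_def
    by (intro continuous_intros DERIV_continuous_on[OF heat_density_deriv[OF K(1), THEN DERIV_subset]]) auto
  have cV: "continuous_on {0..t} V"
    by (intro DERIV_continuous_on[OF dV[THEN DERIV_subset]]) auto
  have cw': "continuous_on {0..t} w'"
    unfolding w'_def using Ve e
    by (intro continuous_intros cE cV) force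
  have w'0: "0 \<le> w' s" for s
    unfolding w'_def using E0 by simp
  \<comment> \<open>\<open>spectral_profile_le\<close> for the density, whose mean is \<open>1\<close>, with \<open>4/V\<close> written as \<open>w\<close>.\<close>
  have key: "2 \<le> F (w s) * w' s" if s: "0 \<le> s" "s \<le> t" for s
  proof -
    have Vs: "0 < V s" using Ve[OF s(2)] e by simp
    have pos: "spectral_profile K \<pi> (w s) \<noteq> 0"
      using w0 w_mono[OF s] wt[OF s(2)] False
      by (intro spectral_profile_nonzero_if_integral_finite[where a="4 * pi_star \<pi>" and b="4 / e"]) auto
    have "spectral_profile K \<pi> (w s) \<le> ennreal (2 * E s / V s)"
      using spectral_profile_le[OF K(1,2), of "h s"] Vs s heat_kernel_nonneg[OF K(1)] less_imp_le[OF K(3)]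
        heat_density_mean[OF K, of y s]
      by (simp add: w_def V_def E_def h_def) (simp add: heat_density_def)
    moreover from this obtain L where L: "spectral_profile K \<pi> (w s) = ennreal L" "0 \<le> L"
      by (cases "spectral_profile K \<pi> (w s)") (auto simp: top_unique)
    ultimately have "L \<le> 2 * E s / V s" "0 < L"
      using E0 Vs pos by (auto simp: ennreal_le_iff less_le)
    moreover have "0 < w s" using Vs by (simp add: w_def)
    moreover have "F (w s) = 2 / (w s * L)"
      unfolding F_def L(1) using \<open>0 < L\<close> \<open>0 < w s\<close>
      by (simp flip: ennreal_mult'' ennreal_numeral add: divide_ennreal)
    moreover have "w' s = w s * (2 * E s / V s)"
      by (simp add: w_def w'_def power2_eq_square)
    ultimately have "F (w s) * w' s = 2 * ((2 * E s / V s) / L)" "1 \<le> (2 * E s / V s) / L"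
      by (simp, simp only: le_divide_eq_1_pos)
    then show ?thesis by linarith
  qed
  have "ennreal (2 * t) = (\<integral>\<^sup>+ s. 2 * indicator {0..t} s \<partial>lborel)"
    using t by (simp add: nn_integral_cmult_indicator ennreal_mult')
  also have "\<dots> \<le> (\<integral>\<^sup>+ s. ennreal (F (w s) * w' s * indicator {0..t} s) \<partial>lborel)"
    by (intro nn_integral_mono) (use key in \<open>auto simp: indicator_def simp flip: ennreal_numeral intro!: ennreal_leI\<close>)
  also have "\<dots> = (\<integral>\<^sup>+ v. ennreal (F v * indicator {w 0..w t} v) \<partial>lborel)"
  proof (rule nn_integral_substitution[symmetric])
    show "set_borel_measurable borel {w 0..w t} F"
      unfolding F_def set_borel_measurable_def by measurable
  qed (use dw w'0 cw' t in auto)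
  also have "\<dots> \<le> ?I"
  proof (intro nn_integral_mono)
    fix v
    have "ennreal (F v) \<le> 2 / (ennreal v * spectral_profile K \<pi> v)"
      by (simp add: F_def ennreal_enn2real_if)
    moreover have "{w 0..w t} \<subseteq> {4 * pi_star \<pi>..4 / e}"
      using w0 wt[of t] by auto
    ultimately show "ennreal (F v * indicator {w 0..w t} v)
        \<le> 2 / (ennreal v * spectral_profile K \<pi> v) * indicator {4 * pi_star \<pi>..4 / e} v"
      by (auto simp: indicator_def)
  qed
  finally show ?thesis .
qed simp

section \<open>From variance to uniform distance\<close>

text \<open>Here \<open>H\<^sub>t(x,z) / \<pi>(z)\<close> is the density at \<open>z\<close> of the reversed chain with target \<open>x\<close>. The
  semigroup property thus turns the relative error at time \<open>2t\<close> into an inner product of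
  centred densities, to which \<open>2\<bar>ab\<bar> \<le> a\<^sup>2 + b\<^sup>2\<close> applies.\<close>

lemma heat_kernel_uniform_bound:
  assumes K: "markov_kernel K" "invariant_prob K \<pi>" "\<And>x. 0 < \<pi> x"
    and y: "Var \<pi> (heat_density K \<pi> y t) \<le> e"
    and x: "Var \<pi> (heat_density (time_reversal K \<pi>) \<pi> x t) \<le> e"
  shows "\<bar>(heat_kernel K (2 * t) x y - \<pi> y) / \<pi> y\<bar> \<le> e"
proof -
  let ?f = "heat_density (time_reversal K \<pi>) \<pi> x t" and ?g = "heat_density K \<pi> y t"
  note R = time_reversal_markov[OF K] time_reversal_invariant[OF K] K(3)
  have p1: "sum \<pi> UNIV = 1" using K(2) by (simp add: invariant_prob_def)
  have "(\<Sum>z\<in>UNIV. (?f z - 1) * (?g z - 1) * \<pi> z)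
      = (\<Sum>z\<in>UNIV. ?f z * ?g z * \<pi> z) - mean \<pi> ?f - mean \<pi> ?g + sum \<pi> UNIV"
    by (simp add: algebra_simps sum.distrib sum_subtractf)
  also have "(\<Sum>z\<in>UNIV. ?f z * ?g z * \<pi> z) = heat_kernel K (t + t) x y / \<pi> y"
    unfolding heat_kernel_add[OF K(1)] sum_divide_distrib
    using K(3) by (intro sum.cong refl)
      (simp add: heat_density_def heat_kernel_time_reversal[OF K(1,3)] less_imp_neq[symmetric])
  finally have "(heat_kernel K (2 * t) x y - \<pi> y) / \<pi> y
      = (\<Sum>z\<in>UNIV. (?f z - 1) * (?g z - 1) * \<pi> z)"
    using K(3)[of y] by (simp add: heat_density_mean[OF K] heat_density_mean[OF R] p1 diff_divide_distrib)
  then have "\<bar>(heat_kernel K (2 * t) x y - \<pi> y) / \<pi> y\<bar>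
      \<le> (\<Sum>z\<in>UNIV. \<bar>(?f z - 1) * (?g z - 1) * \<pi> z\<bar>)"
    by (simp only: sum_abs)
  also have "\<dots> \<le> (\<Sum>z\<in>UNIV. ((?f z - 1)\<^sup>2 * \<pi> z + (?g z - 1)\<^sup>2 * \<pi> z) / 2)"
  proof (intro sum_mono)
    fix z
    have "\<bar>a * b * p\<bar> \<le> (a\<^sup>2 * p + b\<^sup>2 * p) / 2" if "0 < p" for a b p :: real
    proof -
      have "2 * \<bar>a\<bar> * \<bar>b\<bar> * p \<le> (\<bar>a\<bar>\<^sup>2 + \<bar>b\<bar>\<^sup>2) * p"
        using that by (intro mult_right_mono sum_squares_bound) simp
      with that show ?thesis by (simp add: abs_mult algebra_simps)
    qed
    then show "\<bar>(?f z - 1) * (?g z - 1) * \<pi> z\<bar> \<le> ((?f z - 1)\<^sup>2 * \<pi> z + (?g z - 1)\<^sup>2 * \<pi> z) / 2"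
      using K(3) .
  qed
  also have "\<dots> = (Var \<pi> ?f + Var \<pi> ?g) / 2"
    by (simp add: Var_def heat_density_mean[OF K] heat_density_mean[OF R] sum.distrib
        sum_divide_distrib[symmetric])
  also have "\<dots> \<le> e" using x y by simp
  finally show ?thesis .
qed

theorem theorem1p1:
  fixes K :: "'a::finite \<Rightarrow> 'a \<Rightarrow> real" and \<pi> :: "'a \<Rightarrow> real" and \<epsilon> :: real
  assumes "markov_kernel K"
    and "irreducible_kernel K"
    and "invariant_prob K \<pi>"
    and "\<epsilon> > 0"
  shows "mixing_time_inf K \<pi> \<epsilon>
    \<le> (\<integral>\<^sup>+ v\<in>{4 * pi_star \<pi>..4 / \<epsilon>}. 2 / (ennreal v * spectral_profile K \<pi> v) \<partial>lborel)"
    (is "_ \<le> ?I")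
  \<comment> \<open>The variance bound is available at times strictly beyond the integral, so the integral is
    approached from above.\<close>
proof (rule dense_ge)
  fix b assume b: "?I < b"
  have pos: "0 < \<pi> x" for x by (rule invariant_prob_pos[OF assms(1-3)])
  note R = time_reversal_markov[OF assms(1,3) pos] time_reversal_invariant[OF assms(1,3) pos] pos
  show "mixing_time_inf K \<pi> \<epsilon> \<le> b"
  proof (cases b)
    case (real r)
    \<comment> \<open>At time \<open>r / 2\<close> all variances are at most \<open>\<epsilon>\<close>, hence \<open>r\<close> competes in the infimum.\<close>
    have r: "0 < r" using b real by (metis ennreal_neg not_less not_less_zero)
    have "Var \<pi> (heat_density K \<pi> y (r / 2)) \<le> \<epsilon>" for y
      using large_Var_time_le_integral[OF assms(1,3) pos assms(4), of "r / 2" y] b r real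
      by (force simp: not_le)
    moreover have "Var \<pi> (heat_density (time_reversal K \<pi>) \<pi> x (r / 2)) \<le> \<epsilon>" for x
      using large_Var_time_le_integral[OF R assms(4), of "r / 2" x] b r real
      by (force simp: not_le spectral_profile_time_reversal[OF assms(1,3) pos])
    ultimately have "\<bar>(heat_kernel K (2 * (r / 2)) x y - \<pi> y) / \<pi> y\<bar> \<le> \<epsilon>" for x y
      by (intro heat_kernel_uniform_bound[OF assms(1,3) pos])
    then have "(SUP (x, y)\<in>UNIV. \<bar>(heat_kernel K r x y - \<pi> y) / \<pi> y\<bar>) \<le> \<epsilon>"
      by (intro cSUP_least) auto
    then show ?thesis
      unfolding mixing_time_inf_def real using r by (intro INF_lower) auto
  qed simp
qed

end
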